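(* Let $P$ be a combinatorial simple $n$-polytope. There is a one-to-one correspondence between equivalence classes of omnioriented quasitoric manifolds over $P$ with positive orientation on $P$ and nondegenerate simplicial maps $$f\colon \partial P^*\longrightarrow X(\mathbb{Z}^n)$$ modulo the natural action of $\mathrm{Aut}(\mathbb{Z}^n)$.
   Context: A set $\{v_1,\ldots,v_k\}\subset\mathbb{Z}^n$ is unimodular if its span is a direct summand of $\mathbb{Z}^n$ of rank $k$; $X(\mathbb{Z}^n)$ is the simplicial complex whose simplices are all unimodular subsets of $\mathbb{Z}^n$. $\mathrm{Aut}(\mathbb{Z}^n)$ is the group of automorphisms of $\mathbb{Z}^n$; it acts on $X(\mathbb{Z}^n)$, and hence on simplicial maps into $X(\mathbb{Z}^n)$ by post-composition. $\partial P^*$ is the simplicial complex that is the boundary of the polytope dual to the simple polytope $P$: its vertices correspond to the facets of $P$, and a set of vertices is a simplex iff the corresponding facets of $P$ have nonempty intersection. A simplicial map is nondegenerate if it is injective on every simplex. A quasitoric manifold over $P$ is a $2n$-manifold with a locally standard action of the torus $(S^1)^n$ having $P$ as its orbit space. It is determined by $P$ and a characteristic map $\lambda$ assigning to each facet $F$ of $P$ a vector $\lambda(F)\in\mathbb{Z}^n$, determined up to sign, such that $\{\lambda(F_{i_1}),\ldots,\lambda(F_{i_k})\}$ is unimodular whenever $F_{i_1}\cap\cdots\cap F_{i_k}\neq\emptyset$. A choice of omniorientation on a quasitoric manifold over $P$ is equivalent to a choice of orientation on $P$ together with a choice of the facet vectors $\lambda(F_i)$; "with positive orientation on $P$" refers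 to the chosen orientation of $P$ being the positive one. A combinatorial quasitoric pair $(P,\Lambda)$ consists of an oriented combinatorial simple $n$-polytope $P$ with $m$ facets and an $n\times m$ integer matrix $\Lambda$ such that for each vertex $v$ of $P$ the minor $\Lambda_v$ of $\Lambda$, consisting of the columns whose facets contain $v$, is invertible (over $\mathbb{Z}$). Two pairs $(P,\Lambda)$ and $(P',\Lambda')$ are equivalent if $P=P'$ with the same orientation and $\Lambda=\Phi\Lambda'$ for some $n\times n$ integer matrix $\Phi$ of determinant $1$. By a theorem of Buchstaber, Panov and Ray, there is a one-to-one correspondence between equivalence classes of omnioriented quasitoric manifolds and equivalence classes of combinatorial quasitoric pairs; omnioriented quasitoric manifolds are described here through this correspondence.
   Formalization: As stated it fails for a segment (4 classes, 2 orbits of maps); proved instead: equivalence classes correspond to nondegenerate maps modulo determinant-1 automorphisms, and classes modulo Aut(Z^n) correspond to maps modulo Aut(Z^n). *)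

theory Defs
  imports
    "HOL-Analysis.Polytope"
    "HOL-Algebra.Bij"
    "Jordan_Normal_Form.VS_Connect"
begin

section \<open>The lattice and its automorphisms\<close>

abbreviation Z_module :: "nat \<Rightarrow> (int, int vec) module" where
  "Z_module n \<equiv> module_vec TYPE(int) n"

abbreviation Z_span :: "nat \<Rightarrow> int vec set \<Rightarrow> int vec set" where
  "Z_span n \<equiv> LinearCombinations.module.span class_ring (Z_module n)"

abbreviation Z_lin_dep :: "nat \<Rightarrow> int vec set \<Rightarrow> bool" where
  "Z_lin_dep n \<equiv> LinearCombinations.module.lin_dep class_ring (Z_module n)"

definition direct_summand :: "nat \<Rightarrow> int vec set \<Rightarrow> bool" where
  "direct_summand n M \<longleftrightarrow> submodule class_ring M (Z_module n) \<and>
     (\<exists>N. submodule class_ring N (Z_module n) \<and> M \<inter> N = {0\<^sub>v n} \<and>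
        LinearCombinations.module.submodule_sum (Z_module n) M N = carrier_vec n)"

text \<open>The rank of a free submodule, given by the cardinality of a basis.
  Every submodule of \<open>\<int>\<^sup>n\<close> is free.\<close>

definition has_rank :: "nat \<Rightarrow> int vec set \<Rightarrow> nat \<Rightarrow> bool" where
  "has_rank n M k \<longleftrightarrow>
     (\<exists>B \<subseteq> M. finite B \<and> card B = k \<and> \<not> Z_lin_dep n B \<and> Z_span n B = M)"

definition Aut_Z :: "nat \<Rightarrow> (int vec \<Rightarrow> int vec) set" where
  "Aut_Z n = auto (monoid_vec TYPE(int) n)"

definition SAut_Z :: "nat \<Rightarrow> (int vec \<Rightarrow> int vec) set" where
  "SAut_Z n = {\<phi> \<in> Aut_Z n. \<exists>\<Phi> \<in> carrier_mat n n. Determinant.det \<Phi> = 1 \<and>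
     (\<forall>v \<in> carrier_vec n. \<phi> v = \<Phi> *\<^sub>v v)}"


section \<open>Simplicial complexes and simplicial maps\<close>

text \<open>A simplicial complex is the set of its simplices, the empty one included; its vertex set
  is the union of its simplices. A simplicial map is given by its values on the vertices and is
  \<open>undefined\<close> elsewhere, so that equality of maps is equality on the vertices.\<close>

definition unimodular :: "nat \<Rightarrow> int vec set \<Rightarrow> bool" where
  "unimodular n S \<longleftrightarrow> finite S \<and> S \<subseteq> carrier_vec n \<and>
     direct_summand n (Z_span n S) \<and> has_rank n (Z_span n S) (card S)"

definition X_Z :: "nat \<Rightarrow> int vec set set" where
  "X_Z n = {S. unimodular n S}"

definition simplicial_maps :: "'v set set \<Rightarrow> 'w set set \<Rightarrow> ('v \<Rightarrow> 'w) set" where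
  "simplicial_maps K L = {f \<in> extensional (\<Union>K). \<forall>S\<in>K. f ` S \<in> L}"

definition nondegenerate :: "'v set set \<Rightarrow> ('v \<Rightarrow> 'w) \<Rightarrow> bool" where
  "nondegenerate K f \<longleftrightarrow> (\<forall>S\<in>K. inj_on f S)"


section \<open>Simple polytopes\<close>

text \<open>A combinatorial polytope is represented by a convex polytope in Euclidean space. All the
  notions below involve it only through the incidence of its vertices and facets.\<close>

definition simple_polytope :: "nat \<Rightarrow> 'a::euclidean_space set \<Rightarrow> bool" where
  "simple_polytope n P \<longleftrightarrow> polytope P \<and> aff_dim P = int n \<and>
     (\<forall>v. v extreme_point_of P \<longrightarrow> card {F. F facet_of P \<and> v \<in> F} = n)"

text \<open>The boundary of the dual polytope. The facet \<open>F\<close> of \<open>P\<close> itself serves as the vertex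
  corresponding to it; intersecting with \<open>P\<close> only matters for the empty simplex.\<close>

definition dual_boundary :: "'a::euclidean_space set \<Rightarrow> 'a set set set" where
  "dual_boundary P = {S. S \<subseteq> {F. F facet_of P} \<and> P \<inter> \<Inter>S \<noteq> {}}"

definition nondegenerate_maps ::
  "nat \<Rightarrow> 'a::euclidean_space set \<Rightarrow> ('a set \<Rightarrow> int vec) set" where
  "nondegenerate_maps n P =
     {f \<in> simplicial_maps (dual_boundary P) (X_Z n). nondegenerate (dual_boundary P) f}"

definition maps_action_rel ::
  "nat \<Rightarrow> 'a::euclidean_space set \<Rightarrow> (int vec \<Rightarrow> int vec) set
     \<Rightarrow> (('a set \<Rightarrow> int vec) \<times> ('a set \<Rightarrow> int vec)) set" where
  "maps_action_rel n P G =
     {(f, g). f \<in> nondegenerate_maps n P \<and> g \<in> nondegenerate_maps n P \<and>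
        (\<exists>\<phi>\<in>G. f = compose (\<Union>(dual_boundary P)) \<phi> g)}"


section \<open>Omnioriented quasitoric manifolds as combinatorial quasitoric pairs\<close>

text \<open>The two orientations of \<open>P\<close>, relative to a reference one.\<close>

datatype orientation = Positive | Negative

text \<open>The list \<open>Fs\<close> enumerates the facets of \<open>P\<close>: column \<open>i\<close> of \<open>\<Lambda>\<close> is the vector
  of the facet \<open>Fs ! i\<close>.\<close>

definition vertex_minor :: "nat \<Rightarrow> 'a set list \<Rightarrow> int mat \<Rightarrow> 'a \<Rightarrow> int mat" where
  "vertex_minor n Fs \<Lambda> v = mat_of_cols n [col \<Lambda> i. i \<leftarrow> [0..<length Fs], v \<in> Fs ! i]"

definition quasitoric_pairs ::
  "nat \<Rightarrow> 'a::euclidean_space set \<Rightarrow> 'a set list \<Rightarrow> (orientation \<times> int mat) set" where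
  "quasitoric_pairs n P Fs = {(\<omega>, \<Lambda>). \<Lambda> \<in> carrier_mat n (length Fs) \<and>
     (\<forall>v. v extreme_point_of P \<longrightarrow> invertible_mat (vertex_minor n Fs \<Lambda> v))}"

definition pair_equiv ::
  "nat \<Rightarrow> 'a::euclidean_space set \<Rightarrow> 'a set list
     \<Rightarrow> ((orientation \<times> int mat) \<times> (orientation \<times> int mat)) set" where
  "pair_equiv n P Fs = {((\<omega>, \<Lambda>), (\<omega>', \<Lambda>')).
     (\<omega>, \<Lambda>) \<in> quasitoric_pairs n P Fs \<and> (\<omega>', \<Lambda>') \<in> quasitoric_pairs n P Fs \<and>
     \<omega> = \<omega>' \<and> (\<exists>\<Phi> \<in> carrier_mat n n. Determinant.det \<Phi> = 1 \<and> \<Lambda> = \<Phi> * \<Lambda>')}"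

definition positive_classes ::
  "nat \<Rightarrow> 'a::euclidean_space set \<Rightarrow> 'a set list \<Rightarrow> (orientation \<times> int mat) set set" where
  "positive_classes n P Fs =
     {(\<omega>, \<Lambda>) \<in> quasitoric_pairs n P Fs. \<omega> = Positive} // pair_equiv n P Fs"

text \<open>Equivalence of pairs only divides out matrices of determinant \<open>1\<close>, while \<open>Aut(\<int>\<^sup>n)\<close> also
  contains automorphisms of determinant \<open>-1\<close>. The latter permute the classes without fixed points.
  So the assignment \<open>\<Lambda> \<mapsto> (F\<^sub>i \<mapsto> \<lambda>(F\<^sub>i))\<close> matches classes with maps modulo \<open>SAut_Z n\<close>, and matches
  classes with maps when \<open>Aut_Z n\<close> is divided out on both sides. Dividing it out on the maps alone
  fails already for a segment: there are \<open>4\<close> classes and \<open>2\<close> orbits of maps.\<close>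

definition pair_act ::
  "nat \<Rightarrow> (int vec \<Rightarrow> int vec) \<Rightarrow> orientation \<times> int mat \<Rightarrow> orientation \<times> int mat" where
  "pair_act n \<phi> = (\<lambda>(\<omega>, \<Lambda>). (\<omega>, mat_of_cols n (map \<phi> (cols \<Lambda>))))"

definition classes_action_rel ::
  "nat \<Rightarrow> 'a::euclidean_space set \<Rightarrow> 'a set list \<Rightarrow> (int vec \<Rightarrow> int vec) set
     \<Rightarrow> ((orientation \<times> int mat) set \<times> (orientation \<times> int mat) set) set" where
  "classes_action_rel n P Fs G =
     {(C, D). C \<in> positive_classes n P Fs \<and> D \<in> positive_classes n P Fs \<and>
        (\<exists>\<phi>\<in>G. C = pair_act n \<phi> ` D)}"

definition facet_map :: "'a set list \<Rightarrow> orientation \<times> int mat \<Rightarrow> 'a set \<Rightarrow> int vec" where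
  "facet_map Fs = (\<lambda>(\<omega>, \<Lambda>). \<lambda>F \<in> set Fs. the (map_of (zip Fs (cols \<Lambda>)) F))"

end

theory Submission
  imports Defs
begin

text \<open>
  A positively oriented pair is just a matrix \<open>\<Lambda>\<close> with one column per facet, and a map on the vertices
  of \<open>\<partial>P\<^sup>*\<close> with values in \<open>\<int>\<^sup>n\<close> is one vector per facet. The content of the theorem is that the conditions
  imposed on the two sides agree and that the two equivalence relations correspond.

  The conditions agree because both can be tested at the vertices of \<open>P\<close>. Every simplex of \<open>\<partial>P\<^sup>*\<close>
  consists of facets through a common vertex (\<open>dual_boundary_iff\<close>), and through each vertex pass
  exactly \<open>n\<close> facets because \<open>P\<close> is simple. For \<open>n\<close> vectors in \<open>\<int>\<^sup>n\<close>, forming an invertible matrix is the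
  same as being distinct and unimodular (\<open>invertible_mat_of_cols_iff\<close>): a direct summand of full
  rank is all of \<open>\<int>\<^sup>n\<close>, and \<open>n\<close> vectors that span \<open>\<int>\<^sup>n\<close> are the columns of an invertible matrix.
  Conversely, any part of a basis is unimodular, so smaller simplices impose nothing new. Hence
  \<open>facet_map\<close> is a bijection from positive pairs onto nondegenerate maps (\<open>bij_betw_facet_map\<close>).

  The relations correspond because automorphisms of \<open>\<int>\<^sup>n\<close> are the integer matrices whose determinant is
  a unit (\<open>Aut_Z_iff_matrix\<close>), and applying \<open>\<Phi>\<close> to the values of the map of \<open>\<Lambda>\<close> gives the map of
  \<open>\<Phi> \<Lambda>\<close> (\<open>facet_map_act\<close>). So \<open>facet_map\<close> carries orbits to orbits, for \<open>Aut(\<int>\<^sup>n)\<close> as well as for its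
  subgroup of determinant \<open>1\<close>. For the latter the orbits of pairs are the equivalence classes, which
  is the first assertion. For the second, dividing the classes by \<open>Aut(\<int>\<^sup>n)\<close> has to be compared with
  dividing the pairs by \<open>Aut(\<int>\<^sup>n)\<close>; this works because matrices of determinant \<open>1\<close> form a normal
  subgroup, so that automorphisms permute the classes (\<open>Union_classes_action_rel\<close>).
\<close>

section \<open>Invertible integer matrices and unimodular sets\<close>

lemma invertible_mat_obtain_inverse:
  fixes A :: "'a::semiring_1 mat"
  assumes A: "A \<in> carrier_mat n n" "invertible_mat A"
  obtains B where "B \<in> carrier_mat n n" "A * B = 1\<^sub>m n" "B * A = 1\<^sub>m n"
proof -
  obtain B where AB: "A * B = 1\<^sub>m n" and BA: "B * A = 1\<^sub>m (dim_row B)"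
    using A by (auto simp: invertible_mat_def inverts_mat_def)
  have "B \<in> carrier_mat n n"
    using arg_cong[OF AB, of dim_col] arg_cong[OF BA, of dim_col] A(1) by auto
  then show ?thesis using that AB BA by simp
qed

lemma invertible_mat_iff_det_dvd_1:
  fixes A :: "'a::comm_ring_1 mat"
  assumes A: "A \<in> carrier_mat n n"
  shows "invertible_mat A \<longleftrightarrow> Determinant.det A dvd 1"
proof
  assume "invertible_mat A"
  then obtain B where "B \<in> carrier_mat n n" and AB: "A * B = 1\<^sub>m n"
    using invertible_mat_obtain_inverse[OF A] by metis
  then have "1 = Determinant.det A * Determinant.det B"
    using AB A det_mult[of A n B] by simp
  then show "Determinant.det A dvd 1" by (rule dvdI)
next
  assume "Determinant.det A dvd 1"
  then obtain c where c: "1 = Determinant.det A * c" by (elim dvdE)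
  let ?B = "c \<cdot>\<^sub>m adj_mat A"
  have B: "?B \<in> carrier_mat n n" using adj_mat(1)[OF A] by simp
  have unit: "c \<cdot>\<^sub>m (Determinant.det A \<cdot>\<^sub>m 1\<^sub>m n) = 1\<^sub>m n"
    using c by (intro eq_matI) (auto simp: mult.commute)
  have "A * ?B = 1\<^sub>m n"
    using adj_mat(1,2)[OF A] unit by (simp add: mult_smult_distrib[OF A])
  moreover have "?B * A = 1\<^sub>m n"
    using mult_smult_assoc_mat[OF adj_mat(1)[OF A] A, of c] adj_mat(3)[OF A] unit by simp
  ultimately
  show "invertible_mat A"
    using A B by (auto simp: invertible_mat_def inverts_mat_def)
qed

lemma Z_span_set_eq_mult_mat_vec:
  assumes vs: "set vs \<subseteq> carrier_vec n"
  shows "Z_span n (set vs) = {mat_of_cols n vs *\<^sub>v w | w. w \<in> carrier_vec (length vs)}"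
proof -
  interpret idom_vec n "TYPE(int)" .
  have d: "\<forall>w\<in>set vs. dim_vec w = n" using vs by auto
  have "span (set vs) = {mat_of_cols n vs *\<^sub>v Matrix.vec (length vs) c | c. True}"
    by (simp add: span_list_as_span[OF vs, symmetric] span_list_def lincomb_list_as_mat_mult[OF d])
  also have "\<dots> = {mat_of_cols n vs *\<^sub>v w | w. w \<in> carrier_vec (length vs)}"
  proof -
    have "\<exists>c. w = Matrix.vec (length vs) c" if "w \<in> carrier_vec (length vs)" for w :: "int vec"
      using that by (intro exI[of _ "vec_index w"]) auto
    then show ?thesis by fastforce
  qed
  finally show ?thesis .
qed

text \<open>A singular integer matrix kills a nonzero integer vector, by clearing denominators in a rational
  one. Its entries are the coefficients of a linear relation between the columns.\<close>

lemma Z_lin_indpt_imp_det_nonzero: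
  assumes vs: "set vs \<subseteq> carrier_vec n" "distinct vs" "length vs = n"
    and indpt: "\<not> Z_lin_dep n (set vs)"
  shows "Determinant.det (mat_of_cols n vs) \<noteq> 0"
proof
  interpret idom_vec n "TYPE(int)" .
  have d: "\<forall>w\<in>set vs. dim_vec w = n" using vs by auto
  assume "Determinant.det (mat_of_cols n vs) = 0"
  moreover have "mat_of_cols n vs \<in> carrier_mat n n" using vs(3) mat_of_cols_carrier(1) by metis
  ultimately obtain w where w: "w \<in> carrier_vec n" "w \<noteq> 0\<^sub>v n"
    "mat_of_cols n vs *\<^sub>v w = 0\<^sub>v n"
    by (auto simp: det_0_iff_vec_prod_zero)
  \<comment> \<open>Linear combinations are indexed by vectors, the entries of \<open>w\<close> by positions; the list is
      distinct, so \<open>c\<close> transports one to the other.\<close>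
  define c where "c = (\<lambda>v. vec_index w (THE i. i < n \<and> vs ! i = v))"
  have c: "c (vs ! i) = vec_index w i" if "i < n" for i
  proof -
    have "(THE j. j < n \<and> vs ! j = vs ! i) = i"
      using that vs(2,3) nth_eq_iff_index_eq by (intro the_equality) blast+
    then show ?thesis by (simp add: c_def)
  qed
  have "lincomb c (set vs) = mat_of_cols n vs *\<^sub>v Matrix.vec n (\<lambda>i. c (vs ! i))"
    using lincomb_as_lincomb_list_distinct[OF vs(1,2)] lincomb_list_as_mat_mult[OF d] vs(3) by simp
  also have "Matrix.vec n (\<lambda>i. c (vs ! i)) = w" using w(1) c by auto
  finally have zero: "lincomb c (set vs) = 0\<^sub>v n" using w(3) by simp
  obtain i where "i < n" "vec_index w i \<noteq> 0"
    using w(1,2) by (metis carrier_vecD eq_vecI index_zero_vec(1) index_zero_vec(2))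
  then have "vs ! i \<in> set vs" "c (vs ! i) \<noteq> 0" using c vs(3) by auto
  then have "lin_dep (set vs)"
    unfolding lin_dep_def using zero by blast
  then show False using indpt by simp
qed

text \<open>Over a field this would be a dimension count. Over \<open>\<int>\<close> it is constructive: if the columns span,
  write each unit vector as \<open>A w\<^sub>j\<close>; the \<open>w\<^sub>j\<close> are the columns of a right inverse, so \<open>det A\<close> is a
  unit.\<close>

lemma invertible_mat_span_cols:
  assumes A: "A \<in> carrier_mat n n"
  shows "invertible_mat A \<longleftrightarrow> Z_span n (set (cols A)) = carrier_vec n"
proof -
  have cols: "set (cols A) \<subseteq> carrier_vec n" using cols_dim[of A] A by simp
  have A': "mat_of_cols n (cols A) = A" using A by auto
  have span: "Z_span n (set (cols A)) = {A *\<^sub>v w | w. w \<in> carrier_vec n}"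
    using Z_span_set_eq_mult_mat_vec[OF cols] A A' by simp
  show ?thesis
  proof
    assume "invertible_mat A"
    then obtain B where B: "B \<in> carrier_mat n n" and AB: "A * B = 1\<^sub>m n"
      using invertible_mat_obtain_inverse[OF A] by metis
    have "v = A *\<^sub>v (B *\<^sub>v v)" if "v \<in> carrier_vec n" for v
      using that A B AB by (simp flip: assoc_mult_mat_vec[OF A B])
    then show "Z_span n (set (cols A)) = carrier_vec n"
      unfolding span using A B mult_mat_vec_carrier by blast
  next
    assume "Z_span n (set (cols A)) = carrier_vec n"
    then have "\<exists>w. w \<in> carrier_vec n \<and> unit_vec n j = A *\<^sub>v w" for j
      using unit_vec_carrier[of n j] unfolding span by blast
    then obtain w where w: "\<And>j. w j \<in> carrier_vec n" "\<And>j. unit_vec n j = A *\<^sub>v w j" by metis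
    define B where "B = mat_of_cols n (map w [0..<n])"
    have B: "B \<in> carrier_mat n n" unfolding B_def using mat_of_cols_carrier(1)[of n "map w [0..<n]"] by simp
    have "A * B = 1\<^sub>m n"
    proof (rule mat_col_eqI)
      fix j assume "j < dim_col (1\<^sub>m n :: int mat)"
      then have j: "j < n" by simp
      then have "col B j = w j" unfolding B_def using w(1) by (subst col_mat_of_cols) auto
      then show "col (A * B) j = col (1\<^sub>m n) j" using w(2)[of j] col_mult2[OF A B j] j by simp
    qed (use A B in auto)
    then have "Determinant.det A * Determinant.det B = 1" using det_mult[OF A B] by simp
    then show "invertible_mat A" unfolding invertible_mat_iff_det_dvd_1[OF A] by (metis dvd_triv_left)
  qed
qed

text \<open>The columns of an invertible matrix form a basis of \<open>\<int>\<^sup>n\<close>. The span of some of them is free on them,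
  and the span of the remaining ones is a complement.\<close>

lemma unimodular_subset_cols:
  assumes A: "A \<in> carrier_mat n n" "invertible_mat A" and T: "T \<subseteq> set (cols A)"
  shows "unimodular n T"
proof -
  interpret idom_vec n "TYPE(int)" .
  let ?B = "set (cols A)" and ?U = "set (cols A) - T"
  have B: "?B \<subseteq> carrier_vec n" using cols_dim[of A] A by simp
  have fin: "finite T" "finite ?U" using T finite_subset by auto
  have TU: "T \<subseteq> carrier_vec n" "?U \<subseteq> carrier_vec n" using T B by auto
  have "Determinant.det A \<noteq> 0" using A invertible_mat_iff_det_dvd_1[OF A(1)] by auto
  then have indpt: "lin_indpt ?B" using lin_dep_cols_imp_det_0[OF A(1)] by blast
  have spanB: "span ?B = carrier_vec n" using A invertible_mat_span_cols by blast
  have subT: "submodule class_ring (span T) V" and subU: "submodule class_ring (span ?U) V"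
    using TU span_is_submodule by auto
  have split: "lincomb a ?B = lincomb a T + lincomb a ?U" for a
  proof -
    have "lincomb a ?B = lincomb a ?U + lincomb a T"
      by (rule lincomb_vec_diff_add[OF B T]) auto
    then show ?thesis using TU fin by (simp add: comm_add_vec[of _ n])
  qed
  have "submodule_sum (span T) (span ?U) = carrier_vec n"
  proof
    show "submodule_sum (span T) (span ?U) \<subseteq> carrier_vec n"
      using span_is_subset2[OF TU(1)] span_is_subset2[OF TU(2)] unfolding submodule_sum_def by auto
    show "carrier_vec n \<subseteq> submodule_sum (span T) (span ?U)"
    proof
      fix x :: "int Matrix.vec" assume "x \<in> carrier_vec n"
      then obtain a where "x = lincomb a ?B" using spanB finite_in_span[of ?B x] B by auto
      then have "x = lincomb a T + lincomb a ?U" using split by simp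
      moreover have "lincomb a T \<in> span T" "lincomb a ?U \<in> span ?U" using fin by auto
      ultimately show "x \<in> submodule_sum (span T) (span ?U)"
        unfolding submodule_sum_def by force
    qed
  qed
  moreover have "span T \<inter> span ?U = {0\<^sub>v n}"
  proof
    show "{0\<^sub>v n} \<subseteq> span T \<inter> span ?U"
      using submodule.zero_closed[OF subT] submodule.zero_closed[OF subU] by (simp add: module_vec_simps)
    show "span T \<inter> span ?U \<subseteq> {0\<^sub>v n}"
    proof
      fix x assume x: "x \<in> span T \<inter> span ?U"
      then obtain a b where a: "x = lincomb a T" and b: "x = lincomb b ?U"
        using finite_in_span[OF fin(1)] finite_in_span[OF fin(2)] TU by (metis IntE)
      \<comment> \<open>\<open>x\<close> is a combination of \<open>T\<close> and one of \<open>?U\<close>; their difference is a relation on the whole basis.\<close>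
      define c where "c = (\<lambda>v. if v \<in> T then a v else - b v)"
      have "lincomb c T = x" unfolding a c_def using TU by (intro lincomb_cong) auto
      moreover have "lincomb c ?U = (-1) \<cdot>\<^sub>v x"
      proof -
        have "lincomb c ?U = lincomb (\<lambda>v. (-1) * b v) ?U"
          unfolding c_def using TU by (intro lincomb_cong) auto
        also have "\<dots> = (-1) \<cdot>\<^sub>v lincomb b ?U"
          by (rule lincomb_smult[OF TU(2)])
        finally show ?thesis using b by simp
      qed
      moreover have "x \<in> carrier_vec n" using a TU fin by auto
      ultimately have "lincomb c ?B = 0\<^sub>v n" using split[of c] by auto
      then have "\<forall>v\<in>?B. c v = 0" using indpt unfolding lin_dep_def by blast
      then have "\<forall>v\<in>T. a v = 0" using T unfolding c_def by (metis subsetD)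
      then show "x \<in> {0\<^sub>v n}" unfolding a using lincomb_zero[OF TU(1), of a] by simp
    qed
  qed
  ultimately have "direct_summand n (span T)"
    unfolding direct_summand_def using subT subU by (intro conjI exI[of _ "span ?U"])
  moreover have "has_rank n (span T) (card T)"
    unfolding has_rank_def
  proof (intro exI conjI)
    show "T \<subseteq> span T" using in_own_span[of T] TU by simp
    show "lin_indpt T" by (rule subset_li_is_li[OF indpt T])
  qed (use fin in auto)
  ultimately show ?thesis unfolding unimodular_def using fin TU by blast
qed

text \<open>A subgroup of \<open>\<int>\<^sup>n\<close> of full rank may be proper, such as \<open>2\<int>\<close> in \<open>\<int>\<close>; being a direct summand rules
  this out. If \<open>A\<close> is the matrix of a basis of the span and \<open>d\<close> its determinant, then
  \<open>d y = A (adj A y)\<close> lies in the span for every \<open>y\<close>. For \<open>y\<close> in the complement it therefore vanishes,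
  and \<open>d \<noteq> 0\<close> gives \<open>y = 0\<close>: the complement is trivial.\<close>

lemma unimodular_full_span:
  assumes S: "unimodular n S" "card S = n"
  shows "Z_span n S = carrier_vec n"
proof -
  interpret idom_vec n "TYPE(int)" .
  obtain B where B: "B \<subseteq> span S" "finite B" "card B = n" "lin_indpt B" "span B = span S"
    using S unfolding unimodular_def has_rank_def by auto
  obtain N where sub: "submodule class_ring (span S) V" and N: "submodule class_ring N V"
    "span S \<inter> N = {0\<^sub>v n}" "submodule_sum (span S) N = carrier_vec n"
    using S unfolding unimodular_def direct_summand_def by auto
  obtain vs where vs: "set vs = B" "distinct vs" using B(2) finite_distinct_list by blast
  have len: "length vs = n" using vs B(3) distinct_card by metis
  have "span S \<subseteq> carrier_vec n" using submodule.subset[OF sub] by (simp add: module_vec_simps)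
  then have vsc: "set vs \<subseteq> carrier_vec n" using B(1) vs by auto
  define A where "A = mat_of_cols n vs"
  have A: "A \<in> carrier_mat n n" using len mat_of_cols_carrier(1)[of n vs] unfolding A_def by simp
  have det: "Determinant.det A \<noteq> 0"
    unfolding A_def using Z_lin_indpt_imp_det_nonzero[OF vsc vs(2) len] B(4) vs by simp
  have span: "span S = {A *\<^sub>v w | w. w \<in> carrier_vec n}"
    using Z_span_set_eq_mult_mat_vec[OF vsc] vs B(5) len unfolding A_def by simp
  have N0: "y = 0\<^sub>v n" if y: "y \<in> N" for y
  proof -
    let ?d = "Determinant.det A"
    have yc: "y \<in> carrier_vec n" using submodule.subset[OF N(1)] y by (auto simp: module_vec_simps)
    have "?d \<cdot>\<^sub>v y = A *\<^sub>v (adj_mat A *\<^sub>v y)"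
    proof -
      have "A *\<^sub>v (adj_mat A *\<^sub>v y) = (?d \<cdot>\<^sub>m 1\<^sub>m n) *\<^sub>v y"
        using adj_mat[OF A] by (simp flip: assoc_mult_mat_vec[OF A adj_mat(1)[OF A] yc])
      also have "\<dots> = ?d \<cdot>\<^sub>v y" using yc by (intro eq_vecI) (simp_all add: scalar_prod_smult_left)
      finally show ?thesis by (rule sym)
    qed
    then have "?d \<cdot>\<^sub>v y \<in> span S"
      unfolding span using mult_mat_vec_carrier[OF adj_mat(1)[OF A] yc] by blast
    moreover have "?d \<cdot>\<^sub>v y \<in> N"
      using submodule.smult_closed[OF N(1), of ?d y] y by (simp add: module_vec_simps class_ring_simps)
    ultimately have "?d \<cdot>\<^sub>v y = 0\<^sub>v n" using N(2) by blast
    then have "?d * vec_index y i = 0" if "i < n" for i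
      using that yc by (metis carrier_vecD index_smult_vec(1) index_zero_vec(1))
    then show ?thesis using det yc by (intro eq_vecI) auto
  qed
  show ?thesis
  proof
    show "carrier_vec n \<subseteq> span S"
    proof
      fix x :: "int Matrix.vec" assume "x \<in> carrier_vec n"
      then have "x \<in> submodule_sum (span S) N" using N(3) by simp
      then obtain m y where "m \<in> span S" "y \<in> N" "x = m + y"
        unfolding submodule_sum_def by auto
      then have "x = m + 0\<^sub>v n" "m \<in> carrier_vec n" using N0 \<open>span S \<subseteq> carrier_vec n\<close> by blast+
      then show "x \<in> span S" using \<open>m \<in> span S\<close> by simp
    qed
  qed fact
qed


text \<open>This is the point at which the vertex condition of a characteristic matrix meets the two conditions
  on a map: distinctness of the columns is nondegeneracy, unimodularity is simpliciality. Distinctness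
  has to be stated separately because the set of entries of a list with repetitions may well be
  unimodular.\<close>

lemma invertible_mat_of_cols_iff:
  assumes vs: "set vs \<subseteq> carrier_vec n" and len: "length vs = n"
  shows "invertible_mat (mat_of_cols n vs) \<longleftrightarrow> distinct vs \<and> unimodular n (set vs)"
proof -
  have A: "mat_of_cols n vs \<in> carrier_mat n n" using len mat_of_cols_carrier(1)[of n vs] by simp
  have cols: "cols (mat_of_cols n vs) = vs" using vs by simp
  show ?thesis
  proof
    assume inv: "invertible_mat (mat_of_cols n vs)"
    have "distinct vs"
    proof (rule ccontr)
      assume "\<not> distinct vs"
      then obtain i j where ij: "i < n" "j < n" "i \<noteq> j" "vs ! i = vs ! j"
        using len by (auto simp: distinct_conv_nth)
      moreover have "col (mat_of_cols n vs) i = col (mat_of_cols n vs) j"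
        using ij vs len by (simp add: subset_iff)
      ultimately have "Determinant.det (mat_of_cols n vs) = 0"
        using det_identical_columns[OF A] by blast
      then show False using inv invertible_mat_iff_det_dvd_1[OF A] by simp
    qed
    then show "distinct vs \<and> unimodular n (set vs)"
      using unimodular_subset_cols[OF A inv, of "set vs"] cols by simp
  next
    assume "distinct vs \<and> unimodular n (set vs)"
    then show "invertible_mat (mat_of_cols n vs)"
      using unimodular_full_span[of n "set vs"] distinct_card[of vs] len
        invertible_mat_span_cols[OF A] cols by simp
  qed
qed

section \<open>Automorphisms as matrices\<close>

lemma ex_inverse_int_mat:
  fixes \<Phi> :: "int mat"
  assumes \<Phi>: "\<Phi> \<in> carrier_mat n n" "Determinant.det \<Phi> dvd 1"
  obtains \<Psi> where "\<Psi> \<in> carrier_mat n n" "\<Phi> * \<Psi> = 1\<^sub>m n" "\<Psi> * \<Phi> = 1\<^sub>m n"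
    "Determinant.det \<Psi> * Determinant.det \<Phi> = 1"
proof -
  obtain \<Psi> where \<Psi>: "\<Psi> \<in> carrier_mat n n" "\<Phi> * \<Psi> = 1\<^sub>m n" "\<Psi> * \<Phi> = 1\<^sub>m n"
    using invertible_mat_obtain_inverse[OF \<Phi>(1)] invertible_mat_iff_det_dvd_1[OF \<Phi>(1)] \<Phi>(2) by metis
  have "Determinant.det \<Psi> * Determinant.det \<Phi> = 1"
    using det_mult[OF \<Psi>(1) \<Phi>(1)] \<Psi>(3) by simp
  then show ?thesis by (rule that[OF \<Psi>])
qed

text \<open>An additive map is automatically \<open>\<int>\<close>-linear. Hence the vectors at which it agrees with its matrix
  form a submodule, which contains the unit vectors and so is everything.\<close>

lemma additive_imp_mult_mat_vec:
  fixes \<phi> :: "int Matrix.vec \<Rightarrow> int Matrix.vec"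
  assumes add: "\<And>v w. v \<in> carrier_vec n \<Longrightarrow> w \<in> carrier_vec n \<Longrightarrow> \<phi> (v + w) = \<phi> v + \<phi> w"
    and closed: "\<And>v. v \<in> carrier_vec n \<Longrightarrow> \<phi> v \<in> carrier_vec m"
    and v: "v \<in> carrier_vec n"
  shows "\<phi> v = mat_of_cols m (map (\<lambda>i. \<phi> (unit_vec n i)) [0..<n]) *\<^sub>v v"
proof -
  interpret idom_vec n "TYPE(int)" .
  define \<Phi> where "\<Phi> = mat_of_cols m (map (\<lambda>i. \<phi> (unit_vec n i)) [0..<n])"
  have \<Phi>: "\<Phi> \<in> carrier_mat m n"
    using mat_of_cols_carrier(1)[of m "map (\<lambda>i. \<phi> (unit_vec n i)) [0..<n]"] by (simp add: \<Phi>_def)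
  have zero: "\<phi> (0\<^sub>v n) = 0\<^sub>v m"
  proof -
    have c: "\<phi> (0\<^sub>v n) \<in> carrier_vec m" using closed by simp
    have "\<phi> (0\<^sub>v n) + \<phi> (0\<^sub>v n) = \<phi> (0\<^sub>v n)" using add[of "0\<^sub>v n" "0\<^sub>v n"] by simp
    then have "vec_index (\<phi> (0\<^sub>v n)) i = 0" if "i < m" for i
      using that c by (metis add_cancel_right_right carrier_vecD index_add_vec(1))
    then show ?thesis using c by (intro eq_vecI) auto
  qed
  have neg: "\<phi> (- w) = - \<phi> w" if w: "w \<in> carrier_vec n" for w
  proof -
    have c: "\<phi> (- w) \<in> carrier_vec m" "\<phi> w \<in> carrier_vec m" using closed w by auto
    have "\<phi> w + \<phi> (- w) = 0\<^sub>v m" using add[of w "- w"] w zero by simp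
    then have "vec_index (\<phi> (- w)) i = - vec_index (\<phi> w) i" if "i < m" for i
      using that c by (metis add_eq_0_iff carrier_vecD index_add_vec(1) index_zero_vec(1))
    then show ?thesis using c by (intro eq_vecI) auto
  qed
  have nat_smult: "\<phi> (int k \<cdot>\<^sub>v w) = int k \<cdot>\<^sub>v \<phi> w" if w: "w \<in> carrier_vec n" for k w
  proof (induction k)
    case 0
    have "0 \<cdot>\<^sub>v w = 0\<^sub>v n" "0 \<cdot>\<^sub>v \<phi> w = 0\<^sub>v m" using w closed[OF w] by auto
    then show ?case using zero by simp
  next
    case (Suc k)
    have "int (Suc k) \<cdot>\<^sub>v w = w + int k \<cdot>\<^sub>v w"
      "int (Suc k) \<cdot>\<^sub>v \<phi> w = \<phi> w + int k \<cdot>\<^sub>v \<phi> w"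
      by (auto intro!: eq_vecI simp: algebra_simps)
    then show ?case using Suc w add by simp
  qed
  have smult: "\<phi> (c \<cdot>\<^sub>v w) = c \<cdot>\<^sub>v \<phi> w" if w: "w \<in> carrier_vec n" for c w
  proof (cases "c \<ge> 0")
    case True
    then show ?thesis using nat_smult[OF w, of "nat c"] by simp
  next
    case False
    then have "c \<cdot>\<^sub>v w = - (int (nat (- c)) \<cdot>\<^sub>v w)" "- (int (nat (- c)) \<cdot>\<^sub>v \<phi> w) = c \<cdot>\<^sub>v \<phi> w"
      by (auto intro!: eq_vecI)
    then show ?thesis using nat_smult[OF w, of "nat (- c)"] neg w by simp
  qed
  have "submodule class_ring {w \<in> carrier_vec n. \<phi> w = \<Phi> *\<^sub>v w} V"
  proof
    show "\<zero>\<^bsub>V\<^esub> \<in> {w \<in> carrier_vec n. \<phi> w = \<Phi> *\<^sub>v w}"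
      using zero \<Phi> by (auto simp: module_vec_simps)
  next
    fix w w' assume "w \<in> {w \<in> carrier_vec n. \<phi> w = \<Phi> *\<^sub>v w}" "w' \<in> {w \<in> carrier_vec n. \<phi> w = \<Phi> *\<^sub>v w}"
    then show "w \<oplus>\<^bsub>V\<^esub> w' \<in> {w \<in> carrier_vec n. \<phi> w = \<Phi> *\<^sub>v w}"
      using add \<Phi> by (auto simp: module_vec_simps mult_add_distrib_mat_vec)
  next
    fix c w assume "w \<in> {w \<in> carrier_vec n. \<phi> w = \<Phi> *\<^sub>v w}"
    moreover from this have "\<Phi> *\<^sub>v (c \<cdot>\<^sub>v w) = c \<cdot>\<^sub>v (\<Phi> *\<^sub>v w)"
      using \<Phi> by (intro eq_vecI) auto
    ultimately show "c \<odot>\<^bsub>V\<^esub> w \<in> {w \<in> carrier_vec n. \<phi> w = \<Phi> *\<^sub>v w}"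
      using smult by (auto simp: module_vec_simps)
  qed (auto simp: module_vec_simps)
  moreover have "set (cols (1\<^sub>m n)) \<subseteq> {w \<in> carrier_vec n. \<phi> w = \<Phi> *\<^sub>v w}"
  proof
    fix w :: "int Matrix.vec" assume "w \<in> set (cols (1\<^sub>m n))"
    then obtain i where i: "i < n" "w = unit_vec n i"
      by (auto simp: in_set_conv_nth)
    have "\<phi> w = col \<Phi> i" using i closed[of "unit_vec n i"] unfolding \<Phi>_def by simp
    also have "\<dots> = \<Phi> *\<^sub>v w" using i \<Phi> col_mult2[OF \<Phi> one_carrier_mat i(1)] by simp
    finally show "w \<in> {w \<in> carrier_vec n. \<phi> w = \<Phi> *\<^sub>v w}" using i by simp
  qed
  ultimately have "span (set (cols (1\<^sub>m n))) \<subseteq> {w \<in> carrier_vec n. \<phi> w = \<Phi> *\<^sub>v w}"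
    by (intro span_is_subset)
  moreover have "span (set (cols (1\<^sub>m n))) = carrier_vec n"
    using invertible_mat_span_cols[of "1\<^sub>m n" n] invertible_mat_iff_det_dvd_1[of "1\<^sub>m n :: int mat" n] by simp
  ultimately show ?thesis using v unfolding \<Phi>_def by blast
qed

text \<open>Automorphisms are functions on all integer vectors with value \<open>undefined\<close> outside \<open>\<int>\<^sup>n\<close>, hence
  the restriction on the matrix side. Surjectivity says that the columns of the matrix span, which makes
  it invertible.\<close>

lemma Aut_Z_iff_matrix:
  "\<phi> \<in> Aut_Z n \<longleftrightarrow>
     (\<exists>\<Phi> \<in> carrier_mat n n. Determinant.det \<Phi> dvd 1 \<and> \<phi> = (\<lambda>v\<in>carrier_vec n. \<Phi> *\<^sub>v v))"
proof
  assume \<phi>: "\<phi> \<in> Aut_Z n"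
  then have ext: "\<phi> \<in> extensional (carrier_vec n)" and bij: "bij_betw \<phi> (carrier_vec n) (carrier_vec n)"
    and add: "\<And>v w. v \<in> carrier_vec n \<Longrightarrow> w \<in> carrier_vec n \<Longrightarrow> \<phi> (v + w) = \<phi> v + \<phi> w"
    and closed: "\<And>v. v \<in> carrier_vec n \<Longrightarrow> \<phi> v \<in> carrier_vec n"
    by (auto simp: Aut_Z_def auto_def Bij_def hom_def monoid_vec_simps)
  define \<Phi> where "\<Phi> = mat_of_cols n (map (\<lambda>i. \<phi> (unit_vec n i)) [0..<n])"
  have \<Phi>: "\<Phi> \<in> carrier_mat n n"
    using mat_of_cols_carrier(1)[of n "map (\<lambda>i. \<phi> (unit_vec n i)) [0..<n]"] by (simp add: \<Phi>_def)
  have eq: "\<phi> v = \<Phi> *\<^sub>v v" if "v \<in> carrier_vec n" for v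
    unfolding \<Phi>_def by (rule additive_imp_mult_mat_vec[OF add closed that])
  have cols: "set (cols \<Phi>) \<subseteq> carrier_vec n" "mat_of_cols n (cols \<Phi>) = \<Phi>"
    using cols_dim[of \<Phi>] \<Phi> by auto
  have "Z_span n (set (cols \<Phi>)) = {\<Phi> *\<^sub>v w | w. w \<in> carrier_vec n}"
    using Z_span_set_eq_mult_mat_vec[OF cols(1)] cols(2) \<Phi> by simp
  also have "\<dots> = \<phi> ` carrier_vec n" using eq by auto
  also have "\<dots> = carrier_vec n" using bij by (rule bij_betw_imp_surj_on)
  finally have "Determinant.det \<Phi> dvd 1"
    using invertible_mat_span_cols[OF \<Phi>] invertible_mat_iff_det_dvd_1[OF \<Phi>] by simp
  moreover have "\<phi> = (\<lambda>v\<in>carrier_vec n. \<Phi> *\<^sub>v v)"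
    using ext eq by (auto simp: fun_eq_iff extensional_def)
  ultimately show "\<exists>\<Phi> \<in> carrier_mat n n. Determinant.det \<Phi> dvd 1 \<and> \<phi> = (\<lambda>v\<in>carrier_vec n. \<Phi> *\<^sub>v v)"
    using \<Phi> by blast
next
  assume "\<exists>\<Phi> \<in> carrier_mat n n. Determinant.det \<Phi> dvd 1 \<and> \<phi> = (\<lambda>v\<in>carrier_vec n. \<Phi> *\<^sub>v v)"
  then obtain \<Phi> where \<Phi>: "\<Phi> \<in> carrier_mat n n" "Determinant.det \<Phi> dvd 1"
    and \<phi>: "\<phi> = (\<lambda>v\<in>carrier_vec n. \<Phi> *\<^sub>v v)" by blast
  obtain \<Psi> where \<Psi>: "\<Psi> \<in> carrier_mat n n" "\<Phi> * \<Psi> = 1\<^sub>m n" "\<Psi> * \<Phi> = 1\<^sub>m n"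
    using ex_inverse_int_mat[OF \<Phi>] by metis
  have inv: "\<Psi> *\<^sub>v (\<Phi> *\<^sub>v v) = v" "\<Phi> *\<^sub>v (\<Psi> *\<^sub>v v) = v" if "v \<in> carrier_vec n" for v
    using assoc_mult_mat_vec[OF \<Psi>(1) \<Phi>(1) that, symmetric]
      assoc_mult_mat_vec[OF \<Phi>(1) \<Psi>(1) that, symmetric] \<Psi>(2,3) that by simp_all
  have "bij_betw \<phi> (carrier_vec n) (carrier_vec n)"
    unfolding \<phi>
    by (rule bij_betw_byWitness[where f' = "\<lambda>v. \<Psi> *\<^sub>v v"])
      (use \<Phi>(1) \<Psi>(1) inv in \<open>auto intro!: mult_mat_vec_carrier\<close>)
  then show "\<phi> \<in> Aut_Z n"
    using \<Phi>(1) unfolding \<phi> Aut_Z_def auto_def Bij_def hom_def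
    by (auto simp: monoid_vec_simps mult_add_distrib_mat_vec)
qed

lemma SAut_Z_iff_matrix:
  "\<phi> \<in> SAut_Z n \<longleftrightarrow>
     (\<exists>\<Phi> \<in> carrier_mat n n. Determinant.det \<Phi> = 1 \<and> \<phi> = (\<lambda>v\<in>carrier_vec n. \<Phi> *\<^sub>v v))"
proof
  assume \<phi>: "\<phi> \<in> SAut_Z n"
  then obtain \<Phi> where \<Phi>: "\<Phi> \<in> carrier_mat n n" "Determinant.det \<Phi> = 1"
    "\<And>v. v \<in> carrier_vec n \<Longrightarrow> \<phi> v = \<Phi> *\<^sub>v v"
    unfolding SAut_Z_def by blast
  have "\<phi> \<in> extensional (carrier_vec n)"
    using \<phi> by (simp add: SAut_Z_def Aut_Z_def auto_def Bij_def monoid_vec_simps)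
  then have "\<phi> = (\<lambda>v\<in>carrier_vec n. \<Phi> *\<^sub>v v)"
    using \<Phi>(3) by (auto simp: fun_eq_iff extensional_def)
  then show "\<exists>\<Phi> \<in> carrier_mat n n. Determinant.det \<Phi> = 1 \<and> \<phi> = (\<lambda>v\<in>carrier_vec n. \<Phi> *\<^sub>v v)"
    using \<Phi>(1,2) by blast
next
  assume "\<exists>\<Phi> \<in> carrier_mat n n. Determinant.det \<Phi> = 1 \<and> \<phi> = (\<lambda>v\<in>carrier_vec n. \<Phi> *\<^sub>v v)"
  then obtain \<Phi> where \<Phi>: "\<Phi> \<in> carrier_mat n n" "Determinant.det \<Phi> = 1"
    and \<phi>: "\<phi> = (\<lambda>v\<in>carrier_vec n. \<Phi> *\<^sub>v v)" by blast
  then have "\<phi> \<in> Aut_Z n" unfolding Aut_Z_iff_matrix by (intro bexI[of _ \<Phi>]) simp_all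
  then show "\<phi> \<in> SAut_Z n"
    unfolding SAut_Z_def using \<Phi> by (intro CollectI conjI bexI[of _ \<Phi>]) (simp_all add: \<phi>)
qed

lemma SAut_Z_subset_Aut_Z: "SAut_Z n \<subseteq> Aut_Z n"
  by (auto simp: SAut_Z_def)

lemma mult_mat_of_cols:
  assumes "\<Phi> \<in> carrier_mat m n" "set vs \<subseteq> carrier_vec n"
  shows "mat_of_cols m (map (\<lambda>v. \<Phi> *\<^sub>v v) vs) = \<Phi> * mat_of_cols n vs"
proof (rule mat_col_eqI)
  fix i assume "i < dim_col (\<Phi> * mat_of_cols n vs)"
  then have i: "i < length vs" by simp
  then have "vs ! i \<in> carrier_vec n" using assms(2) by auto
  moreover have "col (\<Phi> * mat_of_cols n vs) i = \<Phi> *\<^sub>v col (mat_of_cols n vs) i"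
    using col_mult2[OF assms(1) mat_of_cols_carrier(1)[of n vs]] i by simp
  ultimately show "col (mat_of_cols m (map (\<lambda>v. \<Phi> *\<^sub>v v) vs)) i = col (\<Phi> * mat_of_cols n vs) i"
    using i assms(1) by simp
qed (use assms in simp_all)

section \<open>Quotients and bijections\<close>

lemma bij_betw_image_quotient:
  assumes h: "bij_betw h A B"
    and R: "\<And>a. a \<in> A \<Longrightarrow> R `` {a} \<subseteq> A"
    and S: "\<And>a. a \<in> A \<Longrightarrow> h ` (R `` {a}) = S `` {h a}"
  shows "bij_betw ((`) h) (A // R) (B // S)"
proof (rule bij_betw_imageI)
  have "inj_on ((`) h) (Pow A)"
    using h by (simp add: bij_betw_def inj_on_image_Pow)
  moreover have "A // R \<subseteq> Pow A" using R by (auto simp: quotient_def)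
  ultimately show "inj_on ((`) h) (A // R)" by (rule inj_on_subset)
  have "(`) h ` (A // R) = (\<lambda>a. h ` (R `` {a})) ` A" by (auto simp: quotient_def)
  also have "\<dots> = (\<lambda>b. S `` {b}) ` (h ` A)" using S by (auto simp: image_image)
  also have "\<dots> = B // S" using h by (auto simp: quotient_def bij_betw_def)
  finally show "(`) h ` (A // R) = B // S" .
qed

text \<open>Blocks of a partition are disjoint and nonempty, so a family of blocks is determined by its union.\<close>

lemma inj_on_Union_Pow_quotient:
  assumes "equiv A R"
  shows "inj_on Union (Pow (A // R))"
proof (rule inj_onI)
  have "X \<in> \<Y>"
    if sub: "\<X> \<in> Pow (A // R)" "\<Y> \<in> Pow (A // R)" and eq: "\<Union>\<X> = \<Union>\<Y>" and X: "X \<in> \<X>" for \<X> \<Y> X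
  proof -
    have "X \<in> A // R" using sub X by blast
    then obtain x where "x \<in> X" using in_quotient_imp_non_empty[OF assms] by blast
    then obtain Y where Y: "Y \<in> \<Y>" "x \<in> Y" using eq X by blast
    then have "Y \<in> A // R" using sub by blast
    then have "X = Y" using quotient_disj[OF assms \<open>X \<in> A // R\<close>] \<open>x \<in> X\<close> Y by blast
    then show ?thesis using Y by simp
  qed
  then show "\<X> = \<Y>" if "\<X> \<in> Pow (A // R)" "\<Y> \<in> Pow (A // R)" "\<Union>\<X> = \<Union>\<Y>" for \<X> \<Y>
    using that by (metis subsetI subset_antisym)
qed

section \<open>Simplices of the dual boundary\<close>

text \<open>The maximal simplices of \<open>\<partial>P\<^sup>*\<close> come from the vertices of \<open>P\<close>: a nonempty intersection of facets
  is a face, and as a polytope it has an extreme point, which is then a vertex of \<open>P\<close>. For the empty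
  simplex the face is \<open>P\<close> itself.\<close>

lemma dual_boundary_iff:
  assumes P: "polytope P" "P \<noteq> {}"
  shows "S \<in> dual_boundary P \<longleftrightarrow> (\<exists>v. v extreme_point_of P \<and> S \<subseteq> {F. F facet_of P \<and> v \<in> F})"
proof
  assume "S \<in> dual_boundary P"
  then have S: "S \<subseteq> {F. F facet_of P}" "P \<inter> \<Inter>S \<noteq> {}" by (auto simp: dual_boundary_def)
  have face: "P \<inter> \<Inter>S face_of P"
  proof (cases "S = {}")
    case True
    then show ?thesis using P polytope_imp_convex face_of_refl by auto
  next
    case False
    then have "\<Inter>S face_of P" using S(1) by (intro face_of_Inter) (auto simp: facet_of_def)
    then show ?thesis using face_of_imp_subset by (metis inf.absorb2)
  qed
  then have "polytope (P \<inter> \<Inter>S)" using P face_of_polytope_polytope by blast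
  then obtain v where "v extreme_point_of (P \<inter> \<Inter>S)"
    using S(2) extreme_point_exists_convex polytope_imp_compact polytope_imp_convex by metis
  then have "v extreme_point_of P" "v \<in> P \<inter> \<Inter>S"
    using extreme_point_of_face[OF face] by auto
  then show "\<exists>v. v extreme_point_of P \<and> S \<subseteq> {F. F facet_of P \<and> v \<in> F}" using S(1) by auto
next
  assume "\<exists>v. v extreme_point_of P \<and> S \<subseteq> {F. F facet_of P \<and> v \<in> F}"
  then show "S \<in> dual_boundary P" by (auto simp: dual_boundary_def extreme_point_of_def)
qed

lemma Union_dual_boundary: "\<Union>(dual_boundary P) = {F. F facet_of P}"
proof
  show "{F. F facet_of P} \<subseteq> \<Union>(dual_boundary P)"
  proof
    fix F assume F: "F \<in> {F. F facet_of P}"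
    then have "P \<inter> F \<noteq> {}" using facet_of_imp_subset by (auto simp: facet_of_def)
    then have "{F} \<in> dual_boundary P" using F by (simp add: dual_boundary_def)
    then show "F \<in> \<Union>(dual_boundary P)" by blast
  qed
qed (auto simp: dual_boundary_def)

section \<open>Characteristic matrices and nondegenerate maps\<close>

text \<open>The left-hand side is what a list comprehension with a guard stands for.\<close>

lemma concat_map_if:
  "concat (map (\<lambda>x. if Q x then [f x] else []) xs) = map f (filter Q xs)"
  by (induction xs) auto

locale simple_polytope_facets =
  fixes n :: nat and P :: "'a::euclidean_space set" and Fs :: "'a set list"
  assumes simple: "simple_polytope n P"
    and distinct_Fs: "distinct Fs"
    and set_Fs: "set Fs = {F. F facet_of P}"
begin

definition positive_pairs :: "(orientation \<times> int mat) set" where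
  "positive_pairs = {(\<omega>, \<Lambda>) \<in> quasitoric_pairs n P Fs. \<omega> = Positive}"

definition facets_at :: "'a \<Rightarrow> 'a set list" where
  "facets_at v = filter (\<lambda>F. v \<in> F) Fs"

lemma polytope_P: "polytope P" "P \<noteq> {}"
  using simple by (auto simp: simple_polytope_def)

lemma distinct_facets_at: "distinct (facets_at v)"
  using distinct_Fs by (simp add: facets_at_def)

lemma set_facets_at: "set (facets_at v) = {F. F facet_of P \<and> v \<in> F}"
  using set_Fs by (auto simp: facets_at_def)

lemma length_facets_at: "v extreme_point_of P \<Longrightarrow> length (facets_at v) = n"
  using simple distinct_card[OF distinct_facets_at] set_facets_at by (metis simple_polytope_def)

lemma Union_dual_boundary_Fs: "\<Union>(dual_boundary P) = set Fs"
  by (simp add: Union_dual_boundary set_Fs)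

lemma facet_at_vertex:
  assumes "F \<in> set Fs" obtains v where "v extreme_point_of P" "F \<in> set (facets_at v)"
  using assms dual_boundary_iff[OF polytope_P] unfolding Union_dual_boundary_Fs[symmetric] set_facets_at
  by blast

text \<open>It suffices to test a map on the maximal simplices. There simplicity of \<open>P\<close> provides exactly \<open>n\<close>
  vectors, so that being unimodular and distinct means forming an invertible matrix; smaller
  simplices are then mapped to subsets of bases.\<close>

lemma nondegenerate_maps_iff:
  "f \<in> nondegenerate_maps n P \<longleftrightarrow> f \<in> extensional (set Fs) \<and> f ` set Fs \<subseteq> carrier_vec n \<and>
     (\<forall>v. v extreme_point_of P \<longrightarrow> invertible_mat (mat_of_cols n (map f (facets_at v))))"
    (is "_ \<longleftrightarrow> ?ext \<and> ?carr \<and> ?inv")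
proof
  assume f: "f \<in> nondegenerate_maps n P"
  have simplex: "unimodular n (f ` set (facets_at v)) \<and> inj_on f (set (facets_at v))"
    if "v extreme_point_of P" for v
  proof -
    have "set (facets_at v) \<in> dual_boundary P"
      using that dual_boundary_iff[OF polytope_P] set_facets_at by blast
    then show ?thesis
      using f by (auto simp: nondegenerate_maps_def nondegenerate_def simplicial_maps_def X_Z_def)
  qed
  have ?ext
    using f by (simp add: nondegenerate_maps_def simplicial_maps_def Union_dual_boundary_Fs)
  moreover have ?carr
  proof
    fix w assume "w \<in> f ` set Fs"
    then obtain F where "F \<in> set Fs" "w = f F" by blast
    then show "w \<in> carrier_vec n"
      using facet_at_vertex simplex unfolding unimodular_def by (metis imageI subsetD)
  qed
  moreover have ?inv
  proof (intro allI impI)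
    fix v assume v: "v extreme_point_of P"
    then have "set (map f (facets_at v)) \<subseteq> carrier_vec n"
      using simplex unfolding unimodular_def by simp
    then show "invertible_mat (mat_of_cols n (map f (facets_at v)))"
      using simplex[OF v] invertible_mat_of_cols_iff length_facets_at[OF v] distinct_facets_at[of v]
      by (simp add: distinct_map)
  qed
  ultimately show "?ext \<and> ?carr \<and> ?inv" by blast
next
  assume f: "?ext \<and> ?carr \<and> ?inv"
  have "f ` S \<in> X_Z n \<and> inj_on f S" if simplex: "S \<in> dual_boundary P" for S
  proof -
    obtain v where v: "v extreme_point_of P" and S: "S \<subseteq> set (facets_at v)"
      using iffD1[OF dual_boundary_iff[OF polytope_P] simplex] unfolding set_facets_at by blast
    let ?A = "mat_of_cols n (map f (facets_at v))"
    have sub: "set (map f (facets_at v)) \<subseteq> carrier_vec n" using f by (auto simp: facets_at_def)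
    have A: "?A \<in> carrier_mat n n"
      using length_facets_at[OF v] mat_of_cols_carrier(1)[of n "map f (facets_at v)"] by simp
    have inv: "invertible_mat ?A" using f v by blast
    have "inj_on f (set (facets_at v))"
      using inv invertible_mat_of_cols_iff[OF sub] length_facets_at[OF v] by (simp add: distinct_map)
    moreover have "f ` S \<subseteq> set (cols ?A)" using sub S by auto
    ultimately show ?thesis
      using unimodular_subset_cols[OF A inv] S inj_on_subset unfolding X_Z_def by blast
  qed
  then show "f \<in> nondegenerate_maps n P"
    using f by (simp add: nondegenerate_maps_def nondegenerate_def simplicial_maps_def Union_dual_boundary_Fs)
qed

lemma facet_map_nth:
  assumes "\<Lambda> \<in> carrier_mat n (length Fs)" "i < length Fs"
  shows "facet_map Fs (\<omega>, \<Lambda>) (Fs ! i) = col \<Lambda> i"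
  using assms distinct_Fs by (simp add: facet_map_def map_of_zip_nth)

lemma facet_map_extensional: "facet_map Fs p \<in> extensional (set Fs)"
  by (cases p) (simp add: facet_map_def)

lemma facet_map_closed:
  assumes "\<Lambda> \<in> carrier_mat n (length Fs)"
  shows "facet_map Fs (\<omega>, \<Lambda>) ` set Fs \<subseteq> carrier_vec n"
proof
  fix w assume "w \<in> facet_map Fs (\<omega>, \<Lambda>) ` set Fs"
  then obtain i where "i < length Fs" "w = facet_map Fs (\<omega>, \<Lambda>) (Fs ! i)"
    by (auto simp: in_set_conv_nth)
  then show "w \<in> carrier_vec n" using facet_map_nth[OF assms] assms col_dim[of \<Lambda> i] by simp
qed

lemma vertex_minor_eq:
  assumes \<Lambda>: "\<Lambda> \<in> carrier_mat n (length Fs)"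
  shows "vertex_minor n Fs \<Lambda> v = mat_of_cols n (map (facet_map Fs (\<omega>, \<Lambda>)) (facets_at v))"
proof -
  let ?is = "filter (\<lambda>i. v \<in> Fs ! i) [0..<length Fs]"
  have "facets_at v = filter (\<lambda>F. v \<in> F) (map ((!) Fs) [0..<length Fs])"
    unfolding facets_at_def by (simp only: map_nth)
  also have "\<dots> = map ((!) Fs) ?is" by (simp add: filter_map o_def)
  finally have "map (facet_map Fs (\<omega>, \<Lambda>)) (facets_at v) = map (col \<Lambda>) ?is"
    using facet_map_nth[OF \<Lambda>] by simp
  then show ?thesis by (simp add: vertex_minor_def concat_map_if)
qed

lemma quasitoric_pairs_iff:
  "(\<omega>, \<Lambda>) \<in> quasitoric_pairs n P Fs \<longleftrightarrow>
     \<Lambda> \<in> carrier_mat n (length Fs) \<and> facet_map Fs (\<omega>, \<Lambda>) \<in> nondegenerate_maps n P"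
proof (cases "\<Lambda> \<in> carrier_mat n (length Fs)")
  case True
  then show ?thesis
    using facet_map_extensional facet_map_closed[OF True]
    by (simp add: quasitoric_pairs_def nondegenerate_maps_iff vertex_minor_eq[OF True, of _ \<omega>])
qed (simp add: quasitoric_pairs_def)

text \<open>Before any quotient is taken, a characteristic matrix and a nondegenerate map are the same data: the
  columns of the one are the values of the other.\<close>

lemma bij_betw_facet_map: "bij_betw (facet_map Fs) positive_pairs (nondegenerate_maps n P)"
proof (rule bij_betw_imageI)
  show "inj_on (facet_map Fs) positive_pairs"
  proof (rule inj_onI)
    fix p q assume pq: "p \<in> positive_pairs" "q \<in> positive_pairs" and eq: "facet_map Fs p = facet_map Fs q"
    from pq obtain \<Lambda> \<Lambda>' where p: "p = (Positive, \<Lambda>)" and q: "q = (Positive, \<Lambda>')"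
      and \<Lambda>: "\<Lambda> \<in> carrier_mat n (length Fs)" "\<Lambda>' \<in> carrier_mat n (length Fs)"
      by (auto simp: positive_pairs_def quasitoric_pairs_def)
    have "\<Lambda> = \<Lambda>'"
    proof (rule mat_col_eqI)
      fix i assume "i < dim_col \<Lambda>'"
      then have "i < length Fs" using \<Lambda> by simp
      then show "col \<Lambda> i = col \<Lambda>' i"
        using facet_map_nth[OF \<Lambda>(1), of i Positive] facet_map_nth[OF \<Lambda>(2), of i Positive] eq p q by simp
    qed (use \<Lambda> in auto)
    then show "p = q" using p q by simp
  qed
next
  show "facet_map Fs ` positive_pairs = nondegenerate_maps n P"
  proof
    show "facet_map Fs ` positive_pairs \<subseteq> nondegenerate_maps n P"
      using quasitoric_pairs_iff by (auto simp: positive_pairs_def)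
    show "nondegenerate_maps n P \<subseteq> facet_map Fs ` positive_pairs"
    proof
      fix f assume f: "f \<in> nondegenerate_maps n P"
      then have ext: "f \<in> extensional (set Fs)" and carr: "f ` set Fs \<subseteq> carrier_vec n"
        using nondegenerate_maps_iff by blast+
      define \<Lambda> where "\<Lambda> = mat_of_cols n (map f Fs)"
      have \<Lambda>: "\<Lambda> \<in> carrier_mat n (length Fs)"
        using mat_of_cols_carrier(1)[of n "map f Fs"] by (simp add: \<Lambda>_def)
      have "facet_map Fs (Positive, \<Lambda>) = f"
      proof (rule extensionalityI[OF facet_map_extensional ext])
        fix F assume "F \<in> set Fs"
        then obtain i where i: "i < length Fs" "F = Fs ! i" by (auto simp: in_set_conv_nth)
        then have "f (Fs ! i) \<in> carrier_vec n" using carr by auto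
        then show "facet_map Fs (Positive, \<Lambda>) F = f F"
          using facet_map_nth[OF \<Lambda>, of i] i by (simp add: \<Lambda>_def)
      qed
      moreover from this have "(Positive, \<Lambda>) \<in> positive_pairs"
        using f \<Lambda> quasitoric_pairs_iff by (simp add: positive_pairs_def)
      ultimately show "f \<in> facet_map Fs ` positive_pairs" by (metis imageI)
    qed
  qed
qed

end

section \<open>The action of invertible matrices on pairs\<close>

context simple_polytope_facets
begin

abbreviation act :: "int mat \<Rightarrow> orientation \<times> int mat \<Rightarrow> orientation \<times> int mat" where
  "act \<Phi> p \<equiv> (fst p, \<Phi> * snd p)"

lemma positive_pairs_iff:
  "p \<in> positive_pairs \<longleftrightarrow> fst p = Positive \<and> snd p \<in> carrier_mat n (length Fs) \<and>
     facet_map Fs p \<in> nondegenerate_maps n P"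
  by (cases p) (auto simp: positive_pairs_def quasitoric_pairs_iff)

lemma facet_map_act:
  assumes \<Phi>: "\<Phi> \<in> carrier_mat n n" and p: "snd p \<in> carrier_mat n (length Fs)"
  shows "facet_map Fs (act \<Phi> p) = compose (set Fs) (\<lambda>v\<in>carrier_vec n. \<Phi> *\<^sub>v v) (facet_map Fs p)"
proof (rule extensionalityI[OF facet_map_extensional compose_extensional])
  obtain \<omega> \<Lambda> where [simp]: "p = (\<omega>, \<Lambda>)" by (cases p)
  have \<Lambda>: "\<Lambda> \<in> carrier_mat n (length Fs)" using p by simp
  have \<Phi>\<Lambda>: "\<Phi> * \<Lambda> \<in> carrier_mat n (length Fs)" using \<Phi> \<Lambda> by simp
  fix F assume F: "F \<in> set Fs"
  then obtain i where i: "i < length Fs" "F = Fs ! i" by (auto simp: in_set_conv_nth)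
  have "facet_map Fs (act \<Phi> p) F = \<Phi> *\<^sub>v col \<Lambda> i"
    using facet_map_nth[OF \<Phi>\<Lambda> i(1), of \<omega>] col_mult2[OF \<Phi> \<Lambda> i(1)] i(2) by simp
  moreover have "facet_map Fs p F = col \<Lambda> i" using facet_map_nth[OF \<Lambda> i(1), of \<omega>] i(2) by simp
  moreover have "col \<Lambda> i \<in> carrier_vec n" using \<Lambda> col_dim[of \<Lambda> i] by simp
  ultimately show "facet_map Fs (act \<Phi> p) F =
      compose (set Fs) (\<lambda>v\<in>carrier_vec n. \<Phi> *\<^sub>v v) (facet_map Fs p) F"
    using F by (simp add: compose_def)
qed

lemma pair_act_eq:
  assumes \<Phi>: "\<Phi> \<in> carrier_mat n n" and p: "snd p \<in> carrier_mat n (length Fs)"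
  shows "pair_act n (\<lambda>v\<in>carrier_vec n. \<Phi> *\<^sub>v v) p = act \<Phi> p"
proof -
  obtain \<omega> \<Lambda> where [simp]: "p = (\<omega>, \<Lambda>)" by (cases p)
  have \<Lambda>: "\<Lambda> \<in> carrier_mat n (length Fs)" using p by simp
  have cols: "set (cols \<Lambda>) \<subseteq> carrier_vec n" "mat_of_cols n (cols \<Lambda>) = \<Lambda>"
    using cols_dim[of \<Lambda>] \<Lambda> by auto
  have "map (\<lambda>v\<in>carrier_vec n. \<Phi> *\<^sub>v v) (cols \<Lambda>) = map (\<lambda>v. \<Phi> *\<^sub>v v) (cols \<Lambda>)"
    using cols(1) by auto
  then have "mat_of_cols n (map (\<lambda>v\<in>carrier_vec n. \<Phi> *\<^sub>v v) (cols \<Lambda>)) = \<Phi> * \<Lambda>"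
    using mult_mat_of_cols[OF \<Phi> cols(1)] cols(2) by (simp only:)
  then show ?thesis by (simp add: pair_act_def)
qed

text \<open>Multiplying \<open>\<Lambda>\<close> by \<open>\<Phi>\<close> multiplies every vertex minor by \<open>\<Phi>\<close>.\<close>

lemma act_closed:
  assumes \<Phi>: "\<Phi> \<in> carrier_mat n n" "Determinant.det \<Phi> dvd 1" and p: "p \<in> positive_pairs"
  shows "act \<Phi> p \<in> positive_pairs"
proof -
  obtain \<Lambda> where p': "p = (Positive, \<Lambda>)" and \<Lambda>: "\<Lambda> \<in> carrier_mat n (length Fs)"
    using p by (cases p) (auto simp: positive_pairs_iff)
  let ?f = "facet_map Fs p" and ?g = "facet_map Fs (act \<Phi> p)"
  have \<Phi>\<Lambda>: "\<Phi> * \<Lambda> \<in> carrier_mat n (length Fs)" using \<Phi> \<Lambda> by simp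
  have f: "?f ` set Fs \<subseteq> carrier_vec n"
    and inv: "\<And>v. v extreme_point_of P \<Longrightarrow> invertible_mat (mat_of_cols n (map ?f (facets_at v)))"
    using p unfolding positive_pairs_iff nondegenerate_maps_iff by blast+
  have "invertible_mat (mat_of_cols n (map ?g (facets_at v)))" if v: "v extreme_point_of P" for v
  proof -
    let ?A = "mat_of_cols n (map ?f (facets_at v))"
    have A: "?A \<in> carrier_mat n n"
      using length_facets_at[OF v] mat_of_cols_carrier(1)[of n "map ?f (facets_at v)"] by simp
    have sub: "set (map ?f (facets_at v)) \<subseteq> carrier_vec n" using f by (auto simp: facets_at_def)
    have "map ?g (facets_at v) = map (\<lambda>w. \<Phi> *\<^sub>v w) (map ?f (facets_at v))"
    proof -
      have "?g F = \<Phi> *\<^sub>v ?f F" if "F \<in> set (facets_at v)" for F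
      proof -
        have "F \<in> set Fs" using that by (simp add: facets_at_def)
        moreover from this have "?f F \<in> carrier_vec n" using f by blast
        ultimately show ?thesis
          using facet_map_act[OF \<Phi>(1), of p] \<Lambda> p' by (simp add: compose_def)
      qed
      then show ?thesis by simp
    qed
    then have "mat_of_cols n (map ?g (facets_at v)) = \<Phi> * ?A"
      using mult_mat_of_cols[OF \<Phi>(1) sub] by (simp only:)
    moreover have "Determinant.det (\<Phi> * ?A) dvd 1"
      using inv[OF v] invertible_mat_iff_det_dvd_1[OF A] \<Phi>(2) det_mult[OF \<Phi>(1) A] by (simp add: abs_mult)
    moreover have "\<Phi> * ?A \<in> carrier_mat n n" using \<Phi>(1) A by simp
    ultimately show ?thesis using invertible_mat_iff_det_dvd_1 by metis
  qed
  moreover have "?g ` set Fs \<subseteq> carrier_vec n" using facet_map_closed[OF \<Phi>\<Lambda>] p' by simp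
  ultimately have "?g \<in> nondegenerate_maps n P"
    unfolding nondegenerate_maps_iff using facet_map_extensional by blast
  then show ?thesis using \<Phi>\<Lambda> p' unfolding positive_pairs_iff by simp
qed

lemma pair_equiv_iff:
  assumes "p \<in> positive_pairs"
  shows "(p, q) \<in> pair_equiv n P Fs \<longleftrightarrow> q \<in> positive_pairs \<and>
     (\<exists>\<Phi>\<in>carrier_mat n n. Determinant.det \<Phi> = 1 \<and> p = act \<Phi> q)"
  using assms by (cases p; cases q) (auto simp: pair_equiv_def positive_pairs_def)

text \<open>Matrices of determinant \<open>1\<close> are normal in the invertible ones: from \<open>p = \<Sigma> q\<close> follows
  \<open>\<Phi> p = (\<Phi> \<Sigma> \<Phi>\<inverse>) (\<Phi> q)\<close>. This is why \<open>Aut(\<int>\<^sup>n)\<close> acts on equivalence classes of pairs.\<close>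

lemma pair_equiv_act:
  assumes pq: "(p, q) \<in> pair_equiv n P Fs" and p: "p \<in> positive_pairs"
    and \<Phi>: "\<Phi> \<in> carrier_mat n n" "Determinant.det \<Phi> dvd 1"
  shows "(act \<Phi> p, act \<Phi> q) \<in> pair_equiv n P Fs"
proof -
  obtain \<Sigma> where q: "q \<in> positive_pairs" and \<Sigma>: "\<Sigma> \<in> carrier_mat n n" "Determinant.det \<Sigma> = 1" "p = act \<Sigma> q"
    using pq pair_equiv_iff[OF p] by blast
  have \<Lambda>: "snd q \<in> carrier_mat n (length Fs)" using q positive_pairs_iff by blast
  obtain \<Psi> where \<Psi>: "\<Psi> \<in> carrier_mat n n" "\<Psi> * \<Phi> = 1\<^sub>m n" "Determinant.det \<Psi> * Determinant.det \<Phi> = 1"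
    using ex_inverse_int_mat[OF \<Phi>] by metis
  let ?T = "\<Phi> * \<Sigma> * \<Psi>"
  have T: "?T \<in> carrier_mat n n" using \<Phi> \<Sigma> \<Psi> by simp
  have "Determinant.det ?T = 1"
    using \<Phi>(1) \<Sigma>(1,2) \<Psi>(1,3) det_mult[of "\<Phi> * \<Sigma>" n \<Psi>] det_mult[of \<Phi> n \<Sigma>] by (simp add: mult.commute)
  moreover have "act \<Phi> p = act ?T (act \<Phi> q)"
  proof -
    have "?T * (\<Phi> * snd q) = \<Phi> * \<Sigma> * (\<Psi> * \<Phi> * snd q)"
      using \<Phi>(1) \<Sigma>(1) \<Psi>(1) \<Lambda> by (simp add: assoc_mult_mat[of _ n n _ n _ "length Fs"])
    also have "\<dots> = \<Phi> * (\<Sigma> * snd q)"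
      using \<Phi>(1) \<Sigma>(1) \<Psi>(2) \<Lambda> by (simp add: assoc_mult_mat[of _ n n _ n _ "length Fs"])
    finally show ?thesis using \<Sigma>(3) by simp
  qed
  ultimately show ?thesis
    using act_closed[OF \<Phi> p] act_closed[OF \<Phi> q] T pair_equiv_iff[of "act \<Phi> p" "act \<Phi> q"] by blast
qed

lemma act_act:
  assumes "\<Phi> \<in> carrier_mat n n" "\<Psi> \<in> carrier_mat n n" "p \<in> positive_pairs"
  shows "act \<Phi> (act \<Psi> p) = act (\<Phi> * \<Psi>) p"
  using assms positive_pairs_iff[of p] by (simp add: assoc_mult_mat[of _ n n _ n _ "length Fs"])

lemma act_one: "p \<in> positive_pairs \<Longrightarrow> act (1\<^sub>m n) p = p"
  using positive_pairs_iff[of p] left_mult_one_mat[of "snd p" n "length Fs"] by (simp add: prod_eq_iff)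

text \<open>Equivalence of pairs also relates negatively oriented pairs to each other, and is therefore restricted
  to the positive ones.\<close>

lemma equiv_pair_equiv:
  "equiv positive_pairs (Restr (pair_equiv n P Fs) positive_pairs)"
proof (rule equivI)
  show "refl_on positive_pairs (Restr (pair_equiv n P Fs) positive_pairs)"
  proof (rule refl_onI)
    fix p assume p: "p \<in> positive_pairs"
    then have "(p, p) \<in> pair_equiv n P Fs"
      unfolding pair_equiv_iff[OF p] using act_one by (intro conjI bexI[of _ "1\<^sub>m n"]) simp_all
    then show "(p, p) \<in> Restr (pair_equiv n P Fs) positive_pairs" using p by simp
  qed
  show "sym (Restr (pair_equiv n P Fs) positive_pairs)"
  proof (rule symI)
    fix p q assume "(p, q) \<in> Restr (pair_equiv n P Fs) positive_pairs"
    then have pq: "(p, q) \<in> pair_equiv n P Fs" "p \<in> positive_pairs" "q \<in> positive_pairs" by auto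
    then obtain \<Phi> where \<Phi>: "\<Phi> \<in> carrier_mat n n" "Determinant.det \<Phi> = 1" "p = act \<Phi> q"
      using pair_equiv_iff by blast
    obtain \<Psi> where \<Psi>: "\<Psi> \<in> carrier_mat n n" "\<Psi> * \<Phi> = 1\<^sub>m n" "Determinant.det \<Psi> * Determinant.det \<Phi> = 1"
      using ex_inverse_int_mat[OF \<Phi>(1)] \<Phi>(2) by (metis dvd_refl)
    have "q = act \<Psi> p" using act_act[OF \<Psi>(1) \<Phi>(1) pq(3)] act_one[OF pq(3)] \<Psi>(2) \<Phi>(3) by simp
    moreover have "Determinant.det \<Psi> = 1" using \<Psi>(3) \<Phi>(2) by simp
    ultimately show "(q, p) \<in> Restr (pair_equiv n P Fs) positive_pairs"
      using pair_equiv_iff[OF pq(3)] pq(2,3) \<Psi>(1) by blast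
  qed
  show "trans (Restr (pair_equiv n P Fs) positive_pairs)"
  proof (rule transI)
    fix p q r assume "(p, q) \<in> Restr (pair_equiv n P Fs) positive_pairs" "(q, r) \<in> Restr (pair_equiv n P Fs) positive_pairs"
    then have pq: "(p, q) \<in> pair_equiv n P Fs" "(q, r) \<in> pair_equiv n P Fs"
      and pqr: "p \<in> positive_pairs" "q \<in> positive_pairs" "r \<in> positive_pairs" by auto
    then obtain \<Phi> \<Psi> where \<Phi>: "\<Phi> \<in> carrier_mat n n" "Determinant.det \<Phi> = 1" "p = act \<Phi> q"
      and \<Psi>: "\<Psi> \<in> carrier_mat n n" "Determinant.det \<Psi> = 1" "q = act \<Psi> r"
      using pair_equiv_iff by meson
    have "p = act (\<Phi> * \<Psi>) r" using act_act[OF \<Phi>(1) \<Psi>(1) pqr(3)] \<Phi>(3) \<Psi>(3) by simp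
    moreover have "Determinant.det (\<Phi> * \<Psi>) = 1" "\<Phi> * \<Psi> \<in> carrier_mat n n"
      using det_mult[OF \<Phi>(1) \<Psi>(1)] \<Phi>(1,2) \<Psi>(1,2) by simp_all
    ultimately show "(p, r) \<in> Restr (pair_equiv n P Fs) positive_pairs"
      using pair_equiv_iff[OF pqr(1)] pqr by blast
  qed
qed auto

end

section \<open>Orbits and classes\<close>

context simple_polytope_facets
begin

text \<open>The orbit relation on pairs that corresponds to \<^const>\<open>maps_action_rel\<close>. Both assertions of the
  theorem are about its quotient, for \<open>SAut_Z n\<close> and for \<open>Aut_Z n\<close>.\<close>

definition orbit_rel ::
  "(int Matrix.vec \<Rightarrow> int Matrix.vec) set \<Rightarrow> ((orientation \<times> int mat) \<times> (orientation \<times> int mat)) set" where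
  "orbit_rel G = {(p, q). p \<in> positive_pairs \<and> q \<in> positive_pairs \<and> (\<exists>\<phi>\<in>G. p = pair_act n \<phi> q)}"

lemma Aut_Z_act:
  assumes \<phi>: "\<phi> \<in> Aut_Z n" and q: "q \<in> positive_pairs"
  shows "pair_act n \<phi> q \<in> positive_pairs"
    and "facet_map Fs (pair_act n \<phi> q) = compose (\<Union>(dual_boundary P)) \<phi> (facet_map Fs q)"
proof -
  obtain \<Phi> where \<Phi>: "\<Phi> \<in> carrier_mat n n" "Determinant.det \<Phi> dvd 1"
    and \<phi>': "\<phi> = (\<lambda>v\<in>carrier_vec n. \<Phi> *\<^sub>v v)"
    using \<phi> Aut_Z_iff_matrix by blast
  have q': "snd q \<in> carrier_mat n (length Fs)" using q positive_pairs_iff by blast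
  have eq: "pair_act n \<phi> q = act \<Phi> q" unfolding \<phi>' by (rule pair_act_eq[OF \<Phi>(1) q'])
  show "pair_act n \<phi> q \<in> positive_pairs" unfolding eq by (rule act_closed[OF \<Phi> q])
  show "facet_map Fs (pair_act n \<phi> q) = compose (\<Union>(dual_boundary P)) \<phi> (facet_map Fs q)"
    unfolding eq unfolding \<phi>' Union_dual_boundary_Fs by (rule facet_map_act[OF \<Phi>(1) q'])
qed

text \<open>Equivariance turns orbits of pairs into orbits of maps; injectivity of \<open>facet_map\<close> gives the
  converse, that pairs with maps in one orbit lie in one orbit.\<close>

lemma facet_map_orbit:
  assumes G: "G \<subseteq> Aut_Z n" and p: "p \<in> positive_pairs"
  shows "facet_map Fs ` (orbit_rel G `` {p}) = maps_action_rel n P G `` {facet_map Fs p}"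
proof -
  note inj = bij_betw_imp_inj_on[OF bij_betw_facet_map]
    and surj = bij_betw_imp_surj_on[OF bij_betw_facet_map]
  have rel: "(p, q) \<in> orbit_rel G \<longleftrightarrow> (facet_map Fs p, facet_map Fs q) \<in> maps_action_rel n P G"
    if q: "q \<in> positive_pairs" for q
  proof -
    have "p = pair_act n \<phi> q \<longleftrightarrow> facet_map Fs p = compose (\<Union>(dual_boundary P)) \<phi> (facet_map Fs q)"
      if "\<phi> \<in> G" for \<phi>
      using Aut_Z_act[of \<phi>, OF _ q] inj_on_eq_iff[OF inj p] that G by (metis subsetD)
    moreover have "facet_map Fs p \<in> nondegenerate_maps n P" "facet_map Fs q \<in> nondegenerate_maps n P"
      using surj p q by blast+
    ultimately show ?thesis using p q unfolding orbit_rel_def maps_action_rel_def by blast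
  qed
  have "orbit_rel G `` {p} = {q \<in> positive_pairs. (p, q) \<in> orbit_rel G}"
    by (auto simp: orbit_rel_def)
  moreover have "maps_action_rel n P G `` {facet_map Fs p} =
      {f \<in> facet_map Fs ` positive_pairs. (facet_map Fs p, f) \<in> maps_action_rel n P G}"
    unfolding surj by (auto simp: maps_action_rel_def)
  ultimately show ?thesis using rel by auto
qed

lemma bij_betw_facet_map_orbits:
  assumes "G \<subseteq> Aut_Z n"
  shows "bij_betw ((`) (facet_map Fs)) (positive_pairs // orbit_rel G)
    (nondegenerate_maps n P // maps_action_rel n P G)"
proof (rule bij_betw_image_quotient[OF bij_betw_facet_map])
  show "orbit_rel G `` {p} \<subseteq> positive_pairs" for p by (auto simp: orbit_rel_def)
qed (rule facet_map_orbit[OF assms])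

lemma orbit_rel_Aut_iff:
  assumes "p \<in> positive_pairs" "q \<in> positive_pairs"
  shows "(p, q) \<in> orbit_rel (Aut_Z n) \<longleftrightarrow>
    (\<exists>\<Phi>\<in>carrier_mat n n. Determinant.det \<Phi> dvd 1 \<and> p = act \<Phi> q)"
proof -
  have "snd q \<in> carrier_mat n (length Fs)" using assms(2) positive_pairs_iff by blast
  then have "(\<exists>\<phi>\<in>Aut_Z n. p = pair_act n \<phi> q) \<longleftrightarrow>
    (\<exists>\<Phi>\<in>carrier_mat n n. Determinant.det \<Phi> dvd 1 \<and> p = act \<Phi> q)"
    unfolding Aut_Z_iff_matrix Bex_def using pair_act_eq by metis
  then show ?thesis using assms by (simp add: orbit_rel_def)
qed

lemma orbit_rel_SAut:
  assumes "p \<in> positive_pairs"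
  shows "orbit_rel (SAut_Z n) `` {p} = pair_equiv n P Fs `` {p}"
proof -
  have "(\<exists>\<phi>\<in>SAut_Z n. p = pair_act n \<phi> q) \<longleftrightarrow>
    (\<exists>\<Phi>\<in>carrier_mat n n. Determinant.det \<Phi> = 1 \<and> p = act \<Phi> q)" if "q \<in> positive_pairs" for q
  proof -
    have "snd q \<in> carrier_mat n (length Fs)" using that positive_pairs_iff by blast
    then show ?thesis unfolding SAut_Z_iff_matrix Bex_def using pair_act_eq by metis
  qed
  then show ?thesis using assms pair_equiv_iff[OF assms] unfolding orbit_rel_def by blast
qed

lemma positive_classes_eq: "positive_classes n P Fs = positive_pairs // pair_equiv n P Fs"
  by (simp add: positive_classes_def positive_pairs_def)

lemma pair_equiv_class:
  "p \<in> positive_pairs \<Longrightarrow> pair_equiv n P Fs `` {p} = Restr (pair_equiv n P Fs) positive_pairs `` {p}"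
  using pair_equiv_iff by blast

lemma positive_classes_eq_Restr:
  "positive_classes n P Fs = positive_pairs // Restr (pair_equiv n P Fs) positive_pairs"
  unfolding positive_classes_eq quotient_def using pair_equiv_class by simp

lemma pair_equiv_class_eq_iff:
  assumes "p \<in> positive_pairs" "q \<in> positive_pairs"
  shows "pair_equiv n P Fs `` {p} = pair_equiv n P Fs `` {q} \<longleftrightarrow> (p, q) \<in> pair_equiv n P Fs"
  using eq_equiv_class_iff[OF equiv_pair_equiv assms] assms pair_equiv_class by simp

text \<open>The inclusion from right to left is the other one for the inverse matrix.\<close>

lemma act_pair_equiv_class:
  assumes \<Phi>: "\<Phi> \<in> carrier_mat n n" "Determinant.det \<Phi> dvd 1" and q: "q \<in> positive_pairs"
  shows "act \<Phi> ` (pair_equiv n P Fs `` {q}) = pair_equiv n P Fs `` {act \<Phi> q}"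
proof
  show "act \<Phi> ` (pair_equiv n P Fs `` {q}) \<subseteq> pair_equiv n P Fs `` {act \<Phi> q}"
    using pair_equiv_act[OF _ q \<Phi>] by blast
  show "pair_equiv n P Fs `` {act \<Phi> q} \<subseteq> act \<Phi> ` (pair_equiv n P Fs `` {q})"
  proof
    fix s assume "s \<in> pair_equiv n P Fs `` {act \<Phi> q}"
    then have s: "(act \<Phi> q, s) \<in> pair_equiv n P Fs" by simp
    have \<Phi>q: "act \<Phi> q \<in> positive_pairs" by (rule act_closed[OF \<Phi> q])
    then have sp: "s \<in> positive_pairs" using s pair_equiv_iff by blast
    obtain \<Psi> where \<Psi>: "\<Psi> \<in> carrier_mat n n" "\<Phi> * \<Psi> = 1\<^sub>m n" "\<Psi> * \<Phi> = 1\<^sub>m n"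
      "Determinant.det \<Psi> * Determinant.det \<Phi> = 1"
      by (rule ex_inverse_int_mat[OF \<Phi>])
    have "Determinant.det \<Psi> dvd 1" using \<Psi>(4) by (metis dvd_triv_left)
    then have "(act \<Psi> (act \<Phi> q), act \<Psi> s) \<in> pair_equiv n P Fs"
      by (rule pair_equiv_act[OF s \<Phi>q \<Psi>(1)])
    then have "(q, act \<Psi> s) \<in> pair_equiv n P Fs"
      unfolding act_act[OF \<Psi>(1) \<Phi>(1) q] \<Psi>(3) act_one[OF q] .
    moreover have "s = act \<Phi> (act \<Psi> s)"
      unfolding act_act[OF \<Phi>(1) \<Psi>(1) sp] \<Psi>(2) act_one[OF sp] ..
    ultimately show "s \<in> act \<Phi> ` (pair_equiv n P Fs `` {q})" by blast
  qed
qed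

lemma pair_act_image_class:
  assumes \<Phi>: "\<Phi> \<in> carrier_mat n n" "Determinant.det \<Phi> dvd 1" and q: "q \<in> positive_pairs"
  shows "pair_act n (\<lambda>v\<in>carrier_vec n. \<Phi> *\<^sub>v v) ` (pair_equiv n P Fs `` {q}) =
    pair_equiv n P Fs `` {act \<Phi> q}"
proof -
  have "pair_act n (\<lambda>v\<in>carrier_vec n. \<Phi> *\<^sub>v v) r = act \<Phi> r" if "r \<in> pair_equiv n P Fs `` {q}" for r
  proof -
    have "r \<in> positive_pairs" using that pair_equiv_iff[OF q] by blast
    then show ?thesis using pair_act_eq[OF \<Phi>(1)] positive_pairs_iff by blast
  qed
  then show ?thesis unfolding act_pair_equiv_class[OF \<Phi> q, symmetric] by (rule image_cong[OF refl])
qed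

text \<open>Dividing first by determinant \<open>1\<close> and then by \<open>Aut(\<int>\<^sup>n)\<close> is the same as dividing by
  \<open>Aut(\<int>\<^sup>n)\<close> at once: if \<open>\<Phi>\<close> carries the class of \<open>q\<close> to that of \<open>p\<close>, then \<open>p = \<Sigma> \<Phi> q\<close> for some \<open>\<Sigma>\<close> of
  determinant \<open>1\<close>, and \<open>\<Sigma> \<Phi>\<close> is again invertible.\<close>

lemma Union_classes_action_rel:
  assumes p: "p \<in> positive_pairs"
  shows "\<Union>(classes_action_rel n P Fs (Aut_Z n) `` {pair_equiv n P Fs `` {p}}) = orbit_rel (Aut_Z n) `` {p}"
    (is "\<Union>?\<C> = _")
proof
  have classes: "pair_equiv n P Fs `` {q} \<in> positive_classes n P Fs" if "q \<in> positive_pairs" for q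
    using that by (simp add: positive_classes_eq quotientI)
  show "\<Union>?\<C> \<subseteq> orbit_rel (Aut_Z n) `` {p}"
  proof
    fix q assume "q \<in> \<Union>?\<C>"
    then obtain D \<phi> where D: "D \<in> positive_classes n P Fs" "q \<in> D" and \<phi>: "\<phi> \<in> Aut_Z n"
      and eq: "pair_equiv n P Fs `` {p} = pair_act n \<phi> ` D"
      by (auto simp: classes_action_rel_def)
    obtain \<Phi> where \<Phi>: "\<Phi> \<in> carrier_mat n n" "Determinant.det \<Phi> dvd 1"
      and \<phi>': "\<phi> = (\<lambda>v\<in>carrier_vec n. \<Phi> *\<^sub>v v)"
      using \<phi> Aut_Z_iff_matrix by blast
    obtain d where d: "d \<in> positive_pairs" "D = pair_equiv n P Fs `` {d}"
      using D(1) by (auto simp: positive_classes_eq quotient_def)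
    then have q: "q \<in> positive_pairs" using D(2) pair_equiv_iff by blast
    have "D = pair_equiv n P Fs `` {q}"
      using d D(2) pair_equiv_class_eq_iff[OF d(1) q] by simp
    then have "pair_equiv n P Fs `` {p} = pair_equiv n P Fs `` {act \<Phi> q}"
      using eq pair_act_image_class[OF \<Phi> q] \<phi>' by simp
    then have "(p, act \<Phi> q) \<in> pair_equiv n P Fs"
      using pair_equiv_class_eq_iff[OF p act_closed[OF \<Phi> q]] by simp
    then obtain \<Sigma> where \<Sigma>: "\<Sigma> \<in> carrier_mat n n" "Determinant.det \<Sigma> = 1" "p = act \<Sigma> (act \<Phi> q)"
      using pair_equiv_iff[OF p] by blast
    have "p = act (\<Sigma> * \<Phi>) q" using \<Sigma>(3) act_act[OF \<Sigma>(1) \<Phi>(1) q] by simp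
    moreover have "\<Sigma> * \<Phi> \<in> carrier_mat n n" "Determinant.det (\<Sigma> * \<Phi>) dvd 1"
      using \<Sigma>(1,2) \<Phi> det_mult[OF \<Sigma>(1) \<Phi>(1)] by simp_all
    ultimately have "(p, q) \<in> orbit_rel (Aut_Z n)" using orbit_rel_Aut_iff[OF p q] by blast
    then show "q \<in> orbit_rel (Aut_Z n) `` {p}" by simp
  qed
  show "orbit_rel (Aut_Z n) `` {p} \<subseteq> \<Union>?\<C>"
  proof
    fix q assume "q \<in> orbit_rel (Aut_Z n) `` {p}"
    then have q: "q \<in> positive_pairs" "(p, q) \<in> orbit_rel (Aut_Z n)" by (auto simp: orbit_rel_def)
    then obtain \<Phi> where \<Phi>: "\<Phi> \<in> carrier_mat n n" "Determinant.det \<Phi> dvd 1" "p = act \<Phi> q"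
      using orbit_rel_Aut_iff[OF p q(1)] by blast
    have "pair_equiv n P Fs `` {p} =
        pair_act n (\<lambda>v\<in>carrier_vec n. \<Phi> *\<^sub>v v) ` (pair_equiv n P Fs `` {q})"
      unfolding pair_act_image_class[OF \<Phi>(1,2) q(1)] \<Phi>(3) ..
    moreover have "(\<lambda>v\<in>carrier_vec n. \<Phi> *\<^sub>v v) \<in> Aut_Z n"
      unfolding Aut_Z_iff_matrix using \<Phi>(1,2) by blast
    ultimately have "pair_equiv n P Fs `` {q} \<in> ?\<C>"
      using classes[OF p] classes[OF q(1)] unfolding classes_action_rel_def by blast
    moreover have "q \<in> pair_equiv n P Fs `` {q}"
      using pair_equiv_class_eq_iff[OF q(1) q(1)] by simp
    ultimately show "q \<in> \<Union>?\<C>" by blast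
  qed
qed

text \<open>Elements of the left-hand quotient are sets of classes, and the classes partition the positive
  pairs; taking unions therefore loses nothing.\<close>

lemma bij_betw_Union_classes:
  "bij_betw Union (positive_classes n P Fs // classes_action_rel n P Fs (Aut_Z n))
    (positive_pairs // orbit_rel (Aut_Z n))"
proof (rule bij_betw_imageI)
  let ?Q = "positive_classes n P Fs // classes_action_rel n P Fs (Aut_Z n)"
  have "?Q \<subseteq> Pow (positive_classes n P Fs)"
    by (auto simp: quotient_def classes_action_rel_def)
  then show "inj_on Union ?Q"
    using inj_on_Union_Pow_quotient[OF equiv_pair_equiv] inj_on_subset
    unfolding positive_classes_eq_Restr by blast
  have "Union ` ?Q = (\<lambda>p. \<Union>(classes_action_rel n P Fs (Aut_Z n) `` {pair_equiv n P Fs `` {p}})) ` positive_pairs"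
    unfolding positive_classes_eq quotient_def by auto
  also have "\<dots> = (\<lambda>p. orbit_rel (Aut_Z n) `` {p}) ` positive_pairs"
    by (rule image_cong[OF refl Union_classes_action_rel])
  also have "\<dots> = positive_pairs // orbit_rel (Aut_Z n)" by (auto simp: quotient_def)
  finally show "Union ` ?Q = positive_pairs // orbit_rel (Aut_Z n)" .
qed

end

theorem proposition2p1:
  fixes n :: nat and P :: "'a::euclidean_space set" and Fs :: "'a set list"
  assumes "simple_polytope n P"
    and "distinct Fs" and "set Fs = {F. F facet_of P}"
  shows
    "bij_betw (\<lambda>C. facet_map Fs ` C)
       (positive_classes n P Fs)
       (nondegenerate_maps n P // maps_action_rel n P (SAut_Z n)) \<and>
     bij_betw (\<lambda>\<C>. facet_map Fs ` \<Union>\<C>)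
       (positive_classes n P Fs // classes_action_rel n P Fs (Aut_Z n))
       (nondegenerate_maps n P // maps_action_rel n P (Aut_Z n))"
proof
  interpret simple_polytope_facets n P Fs by unfold_locales fact+
  have "positive_classes n P Fs = positive_pairs // orbit_rel (SAut_Z n)"
    unfolding positive_classes_eq quotient_def using orbit_rel_SAut by simp
  then show "bij_betw (\<lambda>C. facet_map Fs ` C) (positive_classes n P Fs)
      (nondegenerate_maps n P // maps_action_rel n P (SAut_Z n))"
    using bij_betw_facet_map_orbits[OF SAut_Z_subset_Aut_Z] by simp
  show "bij_betw (\<lambda>\<C>. facet_map Fs ` \<Union>\<C>)
      (positive_classes n P Fs // classes_action_rel n P Fs (Aut_Z n))
      (nondegenerate_maps n P // maps_action_rel n P (Aut_Z n))"
    using bij_betw_trans[OF bij_betw_Union_classes bij_betw_facet_map_orbits[OF subset_refl]]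
    by (simp add: o_def)
qed

end
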